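(* Let $X$ be a real Banach space that is strictly convex and $p$-smooth, where $1<p\le 2$, and let $\varepsilon>0$. Then for any $f\in\Gamma_0(X)$ the gradient $\nabla f_\varepsilon:X\to X^*$ of the $p$-Moreau--Yosida regularization $f_\varepsilon$ of $f$ is $(p-1)$-Hölder continuous, i.e. there is a constant $C>0$ such that $$\|\nabla f_\varepsilon(x)-\nabla f_\varepsilon(y)\|\le C\,\|x-y\|^{p-1}\qquad\text{for all }x,y\in X.$$
   Context: $X$ is a real Banach space with topological dual $X^*$; $\|\cdot\|$ denotes the norm on both $X$ and $X^*$. $X$ is strictly convex if $\frac12\|x+y\|<1$ whenever $\|x\|=\|y\|=1$, $x\ne y$. The modulus of smoothness of $X$ is $\rho_X(\tau)=\sup\{\frac12(\|x+y\|+\|x-y\|)-1 \mid x,y\in X,\ \|x\|=1,\ \|y\|=\tau\}$ for $\tau\ge0$. For $p>1$, $X$ is $p$-smooth if there is $c>0$ with $\rho_X(\tau)\le c\tau^p$ for all $\tau\ge 0$ (such a space is uniformly smooth, hence smooth and reflexive). $\Gamma_0(X)$ is the set of convex, lower semicontinuous functions $X\to\mathbb{R}\cup\{+\infty\}$ that are proper, i.e. not identically $+\infty$. The $p$-Moreau--Yosida regularization of $f\in\Gamma_0(X)$ is $f_\varepsilon(x)=\inf\{f(y)+\frac{1}{p\varepsilon}\|x-y\|^p\mid y\in X\}$, $x\in X$. Under the hypotheses of the statement $f_\varepsilon$ is real-valued, convex and Fréchet-differentiable on all of $X$; $\nabla f_\varepsilon(x)\in X^*$ denotes its derivative at $x$.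 *)

theory Defs
  imports "HOL-Analysis.Analysis"
begin

definition strictly_convex_space :: "'a::real_normed_vector itself \<Rightarrow> bool" where
  "strictly_convex_space _ \<longleftrightarrow>
     (\<forall>x y :: 'a. norm x = 1 \<longrightarrow> norm y = 1 \<longrightarrow> x \<noteq> y \<longrightarrow> norm (x + y) / 2 < 1)"

(* The supremum is taken in ereal, so that it is meaningful (namely -\<infinity>) also for the
   zero space, which has no unit vectors. *)
definition modulus_of_smoothness :: "'a::real_normed_vector itself \<Rightarrow> real \<Rightarrow> ereal" where
  "modulus_of_smoothness _ \<tau> =
     Sup {ereal ((norm (x + y) + norm (x - y)) / 2 - 1) | x y :: 'a. norm x = 1 \<and> norm y = \<tau>}"

definition p_smooth_space :: "'a::real_normed_vector itself \<Rightarrow> real \<Rightarrow> bool" where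
  "p_smooth_space X p \<longleftrightarrow>
     (\<exists>c>0. \<forall>\<tau>\<ge>0. modulus_of_smoothness X \<tau> \<le> ereal (c * \<tau> powr p))"

definition lower_semicontinuous :: "('a::topological_space \<Rightarrow> ereal) \<Rightarrow> bool" where
  "lower_semicontinuous f \<longleftrightarrow> (\<forall>x. \<forall>c < f x. \<forall>\<^sub>F y in nhds x. c < f y)"

(* Only used for functions that omit the value -\<infinity>; since 0 * \<infinity> = 0 in ereal, the cases
   u = 0 and v = 0 then impose nothing. *)
definition ereal_convex :: "('a::real_vector \<Rightarrow> ereal) \<Rightarrow> bool" where
  "ereal_convex f \<longleftrightarrow>
     (\<forall>x y. \<forall>u\<ge>0. \<forall>v\<ge>0. u + v = 1 \<longrightarrow>
        f (u *\<^sub>R x + v *\<^sub>R y) \<le> ereal u * f x + ereal v * f y)"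

definition Gamma0 :: "('a::real_normed_vector \<Rightarrow> ereal) set" where
  "Gamma0 = {f. (\<forall>x. f x \<noteq> -\<infinity>) \<and> (\<exists>x. f x \<noteq> \<infinity>) \<and> ereal_convex f \<and> lower_semicontinuous f}"

definition moreau_yosida ::
  "real \<Rightarrow> real \<Rightarrow> ('a::real_normed_vector \<Rightarrow> ereal) \<Rightarrow> 'a \<Rightarrow> ereal" where
  "moreau_yosida p \<epsilon> f x = (INF y. f y + ereal (1 / (p * \<epsilon>) * norm (x - y) powr p))"

(* The Frechet derivative as an element of the dual space 'a \<Rightarrow>\<^sub>L real with the operator norm;
   meaningful at points where g is differentiable. *)
definition gradient :: "('a::real_normed_vector \<Rightarrow> real) \<Rightarrow> 'a \<Rightarrow> ('a \<Rightarrow>\<^sub>L real)" where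
  "gradient g x = Blinfun (frechet_derivative g (at x))"

end

(* Let \<phi> = norm(.)^p / (p \<epsilon>). Smoothness of the space bounds the second difference
   \<phi>(x+h) + \<phi>(x-h) - 2 \<phi>(x) by K norm(h)^p, and this bound passes to the infimal convolution
   with f: move a near-minimizer for x along with x+h and x-h. A convex function with such a bound
   lies between its tangent h \<mapsto> g x + L h and g x + L h + K norm(h)^p; comparing the tangents at
   two points with the values at distance norm(x-y) gives the Hoelder estimate. *)

theory Submission
  imports Defs
begin

section \<open>Real powers\<close>

text \<open>A number in [0,1] is at most its \<open>q\<close>-th power when \<open>q\<close> \<le>
  1. Applied to the fractions a/(a+b) and b/(a+b), whose sum is 1, this gives subadditivity.\<close>

lemma powr_add_le_add_powr:
  fixes a b q :: real
  assumes "0 \<le> a" "0 \<le> b" "0 < q" "q \<le> 1"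
  shows "(a + b) powr q \<le> a powr q + b powr q"
proof (cases "a + b = 0")
  case True
  then show ?thesis using assms by simp
next
  case False
  then have s: "a + b > 0" using assms by linarith
  have *: "c / (a + b) * (a + b) powr q \<le> c powr q" if "0 \<le> c" "c \<le> a + b" for c
  proof (cases "c = 0")
    case False
    then have c: "0 < c" using that by simp
    have "(c / (a + b)) powr 1 \<le> (c / (a + b)) powr q"
      by (rule powr_mono') (use assms that s in auto)
    then have "c / (a + b) \<le> c powr q / (a + b) powr q"
      using c s by (simp add: powr_divide)
    then show ?thesis using s by (simp add: field_simps)
  qed simp
  have "(a + b) powr q = a / (a + b) * (a + b) powr q + b / (a + b) * (a + b) powr q"
    using s by (simp flip: distrib_right add_divide_distrib)
  also have "\<dots> \<le> a powr q + b powr q"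
    using assms by (intro add_mono *) auto
  finally show ?thesis .
qed

text \<open>The right-hand side is the tangent of s^p at 1 plus an error. By the mean value theorem
  the error comes from the variation of p z^(p-1) between z = 1 and s, and subadditivity of the
  power p - 1 \<le> 1 makes that variation at most p |s-1|^(p-1).\<close>

lemma powr_le_tangent_plus_powr:
  fixes s p :: real
  assumes "0 \<le> s" "1 < p" "p \<le> 2"
  shows "s powr p \<le> 1 + p * (s - 1) + p * \<bar>s - 1\<bar> powr p"
proof -
  have deriv: "((\<lambda>z. z powr p) has_real_derivative p * z powr (p - 1)) (at z)" if "0 < z" for z :: real
    using that by (rule has_real_derivative_powr)
  have split: "d * d powr (p - 1) = d powr p" if "0 < d" for d :: real
    using that by (metis powr_mult_base less_imp_le add.commute diff_add_cancel)
  consider "s = 0" | "0 < s" "s < 1" | "s = 1" | "1 < s" using assms by linarith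
  then show ?thesis
  proof cases
    case 2
    obtain z where z: "s < z" "z < 1" "1 powr p - s powr p = (1 - s) * (p * z powr (p - 1))"
      using MVT2[of s 1 "\<lambda>z. z powr p" "\<lambda>z. p * z powr (p - 1)"] 2 deriv by auto
    \<comment> \<open>Left of 1 the derivative must be bounded from below, so subadditivity is
      applied to 1 = z + (1 - z); right of 1 it is applied to z = 1 + (z - 1).\<close>
    have "1 \<le> z powr (p - 1) + (1 - z) powr (p - 1)"
      using powr_add_le_add_powr[of z "1 - z" "p - 1"] z 2 assms by simp
    also have "\<dots> \<le> z powr (p - 1) + (1 - s) powr (p - 1)"
      using z assms by (intro add_left_mono powr_mono2) auto
    finally have "(1 - s) * (p * (1 - (1 - s) powr (p - 1))) \<le> (1 - s) * (p * z powr (p - 1))"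
      using 2 assms by (intro mult_left_mono) auto
    moreover have "(1 - s) * (p * (1 - (1 - s) powr (p - 1))) = p * (1 - s) - p * (1 - s) powr p"
      unfolding split[of "1 - s", symmetric, OF diff_gt_0_iff_gt[THEN iffD2, OF 2(2)]]
      by (simp add: algebra_simps)
    ultimately show ?thesis using z 2 by (simp add: right_diff_distrib)
  next
    case 4
    obtain z where z: "1 < z" "z < s" "s powr p - 1 powr p = (s - 1) * (p * z powr (p - 1))"
      using MVT2[of 1 s "\<lambda>z. z powr p" "\<lambda>z. p * z powr (p - 1)"] 4 deriv by auto
    have "z powr (p - 1) \<le> 1 + (z - 1) powr (p - 1)"
      using powr_add_le_add_powr[of 1 "z - 1" "p - 1"] z assms by simp
    also have "\<dots> \<le> 1 + (s - 1) powr (p - 1)"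
      using z assms by (intro add_left_mono powr_mono2) auto
    finally have "(s - 1) * (p * z powr (p - 1)) \<le> (s - 1) * (p * (1 + (s - 1) powr (p - 1)))"
      using 4 assms by (intro mult_left_mono) auto
    also have "\<dots> = p * (s - 1) + p * (s - 1) powr p"
      unfolding split[of "s - 1", symmetric, OF diff_gt_0_iff_gt[THEN iffD2, OF 4]]
      by (simp add: algebra_simps)
    finally show ?thesis using z 4 by simp
  qed (use assms in auto)
qed

text \<open>For positive arguments this is \<open>powr_convex\<close>. At the endpoint 0 convexity
  reduces to (c z)^p \<le> c z^p for 0 < c < 1, which holds since c^p \<le> c.\<close>

lemma convex_on_powr_nonneg:
  fixes p :: real
  assumes "1 \<le> p"
  shows "convex_on {0..} (\<lambda>x. x powr p)"
proof
  fix t x y :: real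
  assume t: "0 < t" "t < 1" and xy: "x \<in> {0..}" "y \<in> {0..}"
  have scale: "(c * z) powr p \<le> c * z powr p" if "0 < c" "c < 1" "0 \<le> z" for c z :: real
  proof -
    have "c powr p \<le> c powr 1" by (rule powr_mono') (use that assms in auto)
    then show ?thesis using that by (simp add: powr_mult mult_right_mono)
  qed
  consider "x = 0" | "y = 0" | "0 < x" "0 < y" using xy by fastforce
  then show "((1 - t) *\<^sub>R x + t *\<^sub>R y) powr p \<le> (1 - t) * x powr p + t * y powr p"
  proof cases
    case 3
    then show ?thesis using convex_onD[OF powr_convex[OF assms], of t x y] t by simp
  qed (use scale[of t y] scale[of "1 - t" x] t xy in auto)
qed auto

lemma norm_powr_convex:
  fixes a b :: "'a::real_normed_vector" and p u v :: real
  assumes "1 \<le> p" "0 \<le> u" "0 \<le> v" "u + v = 1"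
  shows "norm (u *\<^sub>R a + v *\<^sub>R b) powr p \<le> u * norm a powr p + v * norm b powr p"
proof -
  have "norm (u *\<^sub>R a + v *\<^sub>R b) \<le> u * norm a + v * norm b"
    by (rule norm_triangle_le) (use assms in auto)
  then have "norm (u *\<^sub>R a + v *\<^sub>R b) powr p \<le> (u * norm a + v * norm b) powr p"
    using assms by (intro powr_mono2) auto
  also have "\<dots> \<le> u * norm a powr p + v * norm b powr p"
    using convex_on_powr_nonneg[OF assms(1)] assms(2-) unfolding convex_on_def by auto
  finally show ?thesis .
qed

text \<open>Ensures that the penalty term outgrows a linear minorant of \<open>f\<close>, which
  keeps the infimal convolution above -\<infinity>.\<close>

lemma powr_dominates_linear:
  fixes k M p :: real
  assumes "0 < k" "0 \<le> M" "1 < p"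
  obtains B where "\<And>t. 0 \<le> t \<Longrightarrow> B \<le> k * t powr p - M * t"
proof
  \<comment> \<open>At \<open>T\<close> the two terms balance: k T^(p-1) = M. Beyond
    \<open>T\<close> the difference is nonnegative, before it the linear term costs at most M
    T.\<close>
  define T where "T = (M / k) powr (1 / (p - 1))"
  fix t :: real assume t: "0 \<le> t"
  show "- M * T \<le> k * t powr p - M * t"
  proof (cases "t \<le> T")
    case True
    then have "M * t \<le> M * T" using assms by (intro mult_left_mono) auto
    moreover have "0 \<le> k * t powr p" using assms by simp
    ultimately show ?thesis by linarith
  next
    case False
    have T0: "0 \<le> T" by (simp add: T_def)
    have "M / k = T powr (p - 1)" using assms by (simp add: T_def powr_powr)
    also have "\<dots> \<le> t powr (p - 1)" using False T0 assms by (intro powr_mono2) auto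
    finally have "M * t \<le> k * t powr (p - 1) * t"
      using assms t by (intro mult_right_mono) (auto simp: field_simps)
    also have "\<dots> = k * t powr p"
      using powr_mult_base[OF t, of "p - 1"] by (simp add: algebra_simps)
    finally show ?thesis using T0 assms mult_nonneg_nonneg[of M T] by linarith
  qed
qed

section \<open>The power of the norm in a smooth space\<close>

text \<open>For a unit vector x, the tangent estimate for s^p is applied at s = norm (x + h) and s =
  norm (x - h). The linear parts add up to p times a quantity that the modulus of smoothness bounds,
  and the remainders are bounded through |s - 1| \<le> norm h. Homogeneity of degree p covers the
  other nonzero x.\<close>

lemma norm_powr_second_difference:
  assumes "p_smooth_space TYPE('a::real_normed_vector) p" "1 < p" "p \<le> 2"
  obtains K where "0 < K"
    "\<And>x h :: 'a. norm (x + h) powr p + norm (x - h) powr p - 2 * norm x powr p \<le> K * norm h powr p"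
proof -
  obtain c where c: "c > 0" and "\<And>\<tau>. \<tau> \<ge> 0 \<Longrightarrow> modulus_of_smoothness TYPE('a) \<tau> \<le> ereal (c * \<tau> powr p)"
    using assms(1) unfolding p_smooth_space_def by auto
  then have mod: "modulus_of_smoothness TYPE('a) (norm h) \<le> ereal (c * norm h powr p)" for h :: 'a
    by simp
  \<comment> \<open>The first summand comes from the modulus of smoothness, the second from the two
    tangent remainders. It also gives \<open>K\<close> \<ge> 2, as needed at x = 0, where the
    left-hand side is 2 norm(h)^p.\<close>
  define K where "K = 2 * p * c + 2 * p"
  have unit: "norm (x + h) powr p + norm (x - h) powr p - 2 \<le> K * norm h powr p"
    if x: "norm x = 1" for x h :: 'a
  proof -
    have "ereal ((norm (x + h) + norm (x - h)) / 2 - 1) \<le> modulus_of_smoothness TYPE('a) (norm h)"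
      unfolding modulus_of_smoothness_def by (rule Sup_upper) (use x in blast)
    then have "ereal ((norm (x + h) + norm (x - h)) / 2 - 1) \<le> ereal (c * norm h powr p)"
      using mod[of h] by (rule order_trans)
    then have sum: "norm (x + h) + norm (x - h) - 2 \<le> 2 * (c * norm h powr p)"
      by (simp add: field_simps)
    have one: "norm z powr p \<le> 1 + p * (norm z - 1) + p * norm h powr p"
      if "norm (z - x) = norm h" for z
    proof -
      have "\<bar>norm z - 1\<bar> \<le> norm h" using norm_triangle_ineq3[of z x] that x by simp
      then have "p * \<bar>norm z - 1\<bar> powr p \<le> p * norm h powr p"
        using assms by (intro mult_left_mono powr_mono2) auto
      moreover have "norm z powr p \<le> 1 + p * (norm z - 1) + p * \<bar>norm z - 1\<bar> powr p"
        using assms by (intro powr_le_tangent_plus_powr) auto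
      ultimately show ?thesis by linarith
    qed
    have "norm (x + h) powr p + norm (x - h) powr p - 2
      \<le> p * (norm (x + h) + norm (x - h) - 2) + 2 * p * norm h powr p"
      using one[of "x + h"] one[of "x - h"] by (simp add: algebra_simps)
    also have "\<dots> \<le> p * (2 * (c * norm h powr p)) + 2 * p * norm h powr p"
      using sum assms by (intro add_right_mono mult_left_mono) auto
    finally show ?thesis by (simp add: K_def algebra_simps)
  qed
  show thesis
  proof
    show "0 < K" using assms c by (simp add: K_def add_pos_pos)
    fix x h :: 'a
    show "norm (x + h) powr p + norm (x - h) powr p - 2 * norm x powr p \<le> K * norm h powr p"
    proof (cases "x = 0")
      case True
      have "2 \<le> K" using assms c by (simp add: K_def add_increasing)
      then have "2 * norm h powr p \<le> K * norm h powr p" by (intro mult_right_mono) auto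
      then show ?thesis using True by simp
    next
      case False
      define r where "r = norm x"
      have r: "r > 0" using False by (simp add: r_def)
      have sc: "norm (z /\<^sub>R r) powr p = norm z powr p / r powr p" for z :: 'a
        using r by (simp add: powr_mult powr_divide divide_inverse mult.commute inverse_powr)
      have "norm (x /\<^sub>R r + h /\<^sub>R r) powr p + norm (x /\<^sub>R r - h /\<^sub>R r) powr p - 2
        \<le> K * norm (h /\<^sub>R r) powr p"
        by (rule unit) (use r in \<open>simp add: r_def\<close>)
      then have "norm (x + h) powr p / r powr p + norm (x - h) powr p / r powr p - 2
        \<le> K * (norm h powr p / r powr p)"
        by (simp only: sc flip: scaleR_add_right scaleR_diff_right)
      then have "(norm (x + h) powr p + norm (x - h) powr p - 2 * r powr p) / r powr p
        \<le> (K * norm h powr p) / r powr p"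
        using r by (simp add: diff_divide_distrib add_divide_distrib)
      then show ?thesis using r by (simp add: divide_le_cancel flip: r_def)
    qed
  qed
qed

section \<open>Convex functions with bounded second differences\<close>

text \<open>The one-sided directional derivative of a convex function is sublinear. The
  second-difference bound has order p > 1, so it forces the derivatives along h and -h to cancel,
  which makes the derivative linear; the local upper bound on \<open>g\<close> makes it
  bounded.\<close>

lemma convex_second_difference_tangent:
  fixes g :: "'a::real_normed_vector \<Rightarrow> real"
  assumes conv: "convex_on UNIV g" and p: "1 < p"
    and diff2: "\<And>h. g (x + h) + g (x - h) - 2 * g x \<le> K * norm h powr p"
    and bdd: "\<And>h. norm h \<le> 1 \<Longrightarrow> g (x + h) \<le> M"
  obtains L :: "'a \<Rightarrow>\<^sub>L real"
    where "\<And>h. g x + L h \<le> g (x + h)" "\<And>h. g (x + h) \<le> g x + L h + K * norm h powr p"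
proof -
  define q where "q h t = (g (x + t *\<^sub>R h) - g x) / t" for h and t :: real
  \<comment> \<open>Difference quotients of a convex function increase with t (shown in
    \<open>mono\<close>), so this infimum is the right derivative along h.\<close>
  define D where "D h = Inf (q h ` {0<..})" for h
  have cvx: "g ((1 - t) *\<^sub>R a + t *\<^sub>R b) \<le> (1 - t) * g a + t * g b" if "0 \<le> t" "t \<le> 1" for a b t
    using convex_onD[OF conv] that by auto
  have mono: "q h s \<le> q h t" if "0 < s" "s \<le> t" for h s t
  proof -
    have "(1 - s / t) *\<^sub>R x + (s / t) *\<^sub>R (x + t *\<^sub>R h) = x + s *\<^sub>R h"
      using that by (simp add: algebra_simps)
    then have "g (x + s *\<^sub>R h) \<le> (1 - s / t) * g x + (s / t) * g (x + t *\<^sub>R h)"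
      using cvx[of "s / t" x "x + t *\<^sub>R h"] that by simp
    then have "g (x + s *\<^sub>R h) - g x \<le> s * q h t" using that by (simp add: q_def field_simps)
    then show ?thesis using that by (simp add: q_def field_simps)
  qed
  \<comment> \<open>x is a convex combination of x - h and x + t h. The resulting bound is
    independent of t, so the infimum defining \<open>D\<close> is over a set bounded below.\<close>
  have below: "g x - g (x - h) \<le> q h t" if "0 < t" for h t
  proof -
    define c where "c = 1 / (1 + t)"
    have c: "c * (1 + t) = 1" "0 < c" "1 - c = c * t" using that by (auto simp: c_def field_simps)
    have "(1 - c) *\<^sub>R (x - h) + c *\<^sub>R (x + t *\<^sub>R h) = (c * (1 + t)) *\<^sub>R x"
      unfolding c(3) by (simp add: algebra_simps)
    then have eq: "(1 - c) *\<^sub>R (x - h) + c *\<^sub>R (x + t *\<^sub>R h) = x" by (simp add: c(1))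
    have "g x \<le> (1 - c) * g (x - h) + c * g (x + t *\<^sub>R h)"
      using cvx[of c "x - h" "x + t *\<^sub>R h"] that unfolding eq by (simp add: c_def)
    also have "\<dots> = (t * g (x - h) + g (x + t *\<^sub>R h)) / (1 + t)"
      unfolding c(3) by (simp add: c_def add_divide_distrib)
    finally have "g x * (1 + t) \<le> t * g (x - h) + g (x + t *\<^sub>R h)"
      using that by (simp add: pos_le_divide_eq)
    then show ?thesis using that by (simp add: q_def field_simps)
  qed
  have D_le: "D h \<le> q h t" if "0 < t" for h t
    unfolding D_def by (rule cInf_lower) (use that below in \<open>auto intro!: bdd_belowI2\<close>)
  have D_ge: "c \<le> D h" if "\<And>t. 0 < t \<Longrightarrow> c \<le> q h t" for c h
    unfolding D_def by (rule cInf_greatest) (use that in auto)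
  have D_approx: "\<exists>t>0. q h t < D h + e" if "0 < e" for h e
    using D_ge[of "D h + e" h] that by (meson not_less less_add_same_cancel1)
  have D_scale_ge: "s * D h \<le> D (s *\<^sub>R h)" if "0 < s" for s h
  proof (rule D_ge)
    fix t :: real assume t: "0 < t"
    have "q (s *\<^sub>R h) t = s * q h (t * s)" using that t by (simp add: q_def field_simps)
    then show "s * D h \<le> q (s *\<^sub>R h) t" using D_le[of "t * s" h] that t by simp
  qed
  have D_scale_pos: "D (s *\<^sub>R h) = s * D h" if "0 < s" for s h
  proof (rule antisym[OF _ D_scale_ge[OF that]])
    have "(1 / s) * D (s *\<^sub>R h) \<le> D ((1 / s) *\<^sub>R s *\<^sub>R h)" by (rule D_scale_ge) (use that in simp)
    then show "D (s *\<^sub>R h) \<le> s * D h" using that by (simp add: field_simps)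
  qed
  have D_zero: "D 0 = 0"
    unfolding D_def q_def by (simp add: image_constant_conv)
  have D_subadd: "D (a + b) \<le> D a + D b" for a b
  proof (rule field_le_epsilon)
    fix e :: real assume e: "0 < e"
    obtain s where s: "0 < s" "q a s < D a + e / 2" using D_approx[of "e / 2" a] e by auto
    obtain t where t: "0 < t" "q b t < D b + e / 2" using D_approx[of "e / 2" b] e by auto
    \<comment> \<open>The midpoint of x + 2m a and x + 2m b is x + m (a + b), and 2m is small enough
      for \<open>mono\<close> to compare with the quotients at \<open>s\<close> and
      \<open>t\<close>.\<close>
    define m where "m = min s t / 2"
    have m: "0 < m" "2 * m \<le> s" "2 * m \<le> t" using s t by (auto simp: m_def)
    have eq: "(1 - 1 / 2) *\<^sub>R (x + (2 * m) *\<^sub>R a) + (1 / 2) *\<^sub>R (x + (2 * m) *\<^sub>R b) = x + m *\<^sub>R (a + b)"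
    proof -
      have "(1 - 1 / 2) *\<^sub>R (x + (2 * m) *\<^sub>R a) + (1 / 2) *\<^sub>R (x + (2 * m) *\<^sub>R b)
        = (1 / 2) *\<^sub>R (x + x) + m *\<^sub>R (a + b)" by (simp add: algebra_simps)
      then show ?thesis by (simp flip: scaleR_2)
    qed
    have "g (x + m *\<^sub>R (a + b)) \<le> g (x + (2 * m) *\<^sub>R a) / 2 + g (x + (2 * m) *\<^sub>R b) / 2"
      using cvx[of "1 / 2" "x + (2 * m) *\<^sub>R a" "x + (2 * m) *\<^sub>R b"] unfolding eq by simp
    then have "(g (x + m *\<^sub>R (a + b)) - g x) / m
      \<le> ((g (x + (2 * m) *\<^sub>R a) - g x) / 2 + (g (x + (2 * m) *\<^sub>R b) - g x) / 2) / m"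
      by (intro divide_right_mono) (use m in \<open>auto simp: diff_divide_distrib\<close>)
    then have "q (a + b) m \<le> q a (2 * m) + q b (2 * m)"
      by (simp add: q_def add_divide_distrib mult.commute)
    moreover have "q a (2 * m) \<le> q a s" "q b (2 * m) \<le> q b t" using mono m by auto
    ultimately show "D (a + b) \<le> D a + D b + e" using D_le[of m "a + b"] m s t by linarith
  qed
  have D_minus: "D (- h) = - D h" for h
  proof -
    \<comment> \<open>The quotients along h and -h add up to a second difference divided by t, which
      is O(t^(p-1)) and vanishes as t tends to 0 from the right.\<close>
    have ub: "D h + D (- h) \<le> K * norm h powr p * t powr (p - 1)" if "0 < t" for t
    proof -
      have "D h + D (- h) \<le> q h t + q (- h) t" using D_le that by (intro add_mono) auto
      also have "\<dots> = (g (x + t *\<^sub>R h) + g (x - t *\<^sub>R h) - 2 * g x) / t"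
        using that by (simp add: q_def field_simps)
      also have "\<dots> \<le> K * norm (t *\<^sub>R h) powr p / t"
        using that by (intro divide_right_mono diff2) auto
      also have "\<dots> = K * norm h powr p * t powr (p - 1)"
        using that by (simp add: powr_mult powr_diff)
      finally show ?thesis .
    qed
    have "((\<lambda>t. K * norm h powr p * t powr (p - 1)) \<longlongrightarrow> K * norm h powr p * 0 powr (p - 1)) (at_right 0)"
      by (intro tendsto_intros tendsto_powr' ) (use p in \<open>auto simp: eventually_at_filter\<close>)
    then have "D h + D (- h) \<le> K * norm h powr p * 0 powr (p - 1)"
      by (rule tendsto_lowerbound) (use ub in \<open>auto simp: eventually_at_filter\<close>)
    moreover have "0 \<le> D h + D (- h)" using D_subadd[of h "- h"] D_zero by simp
    ultimately show ?thesis by simp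
  qed
  have D_add: "D (a + b) = D a + D b" for a b
    using D_subadd[of a b] D_subadd[of "a + b" "- b"] D_minus[of b] by simp
  have D_scale: "D (s *\<^sub>R h) = s * D h" for s h
    using D_scale_pos[of s h] D_scale_pos[of "- s" h] D_minus[of "s *\<^sub>R h"] D_zero
    by (cases s "0 :: real" rule: linorder_cases) auto
  have D_tangent: "g x + D h \<le> g (x + h)" for h
    using D_le[of 1 h] by (simp add: q_def)
  have D_bound: "\<bar>D h\<bar> \<le> norm h * (M - g x)" for h
  proof (cases "h = 0")
    case False
    have "D (h /\<^sub>R norm h) \<le> M - g x" if "h \<noteq> 0" for h
      using D_tangent[of "h /\<^sub>R norm h"] bdd[of "h /\<^sub>R norm h"] that by simp
    then have "D h \<le> norm h * (M - g x)" if "h \<noteq> 0" for h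
      using that by (simp add: D_scale field_simps)
    from this[of h] this[of "- h"] False show ?thesis by (simp add: D_minus)
  qed (simp add: D_zero)
  have "bounded_linear D"
    by (rule bounded_linear_intro[where K = "M - g x"]) (use D_add D_scale D_bound in auto)
  then have "blinfun_apply (Blinfun D) = D" by (rule bounded_linear_Blinfun_apply)
  \<comment> \<open>The tangent bound at -h, namely g (x - h) \<ge> g x - D h, is inserted into the
    second-difference bound.\<close>
  moreover have "g (x + h) \<le> g x + D h + K * norm h powr p" for h
    using diff2[of h] D_tangent[of "- h"] D_minus[of h] by simp
  ultimately show thesis using that[of "Blinfun D"] D_tangent by simp
qed

lemma has_derivative_if_powr_remainder:
  fixes g :: "'a::real_normed_vector \<Rightarrow> real" and L :: "'a \<Rightarrow>\<^sub>L real"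
  assumes "1 < p" and "\<And>h. \<bar>g (x + h) - g x - L h\<bar> \<le> K * norm h powr p"
  shows "(g has_derivative blinfun_apply L) (at x)"
proof -
  have "((\<lambda>h. norm (g (x + h) - g x - L h) / norm h) \<longlongrightarrow> 0) (at 0)"
  proof (rule tendsto_sandwich[of "\<lambda>_. 0" _ _ "\<lambda>h. K * norm h powr (p - 1)"])
    have "norm (g (x + h) - g x - L h) / norm h \<le> K * norm h powr (p - 1)" if "h \<noteq> 0" for h
      using divide_right_mono[OF assms(2)[of h], of "norm h"] that by (simp add: powr_diff)
    then show "\<forall>\<^sub>F h in at 0. norm (g (x + h) - g x - L h) / norm h \<le> K * norm h powr (p - 1)"
      by (auto simp: eventually_at_filter)
    have "((\<lambda>h::'a. K * norm h powr (p - 1)) \<longlongrightarrow> K * norm (0::'a) powr (p - 1)) (at 0)"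
      by (intro tendsto_intros tendsto_powr') (use assms(1) in auto)
    then show "((\<lambda>h::'a. K * norm h powr (p - 1)) \<longlongrightarrow> 0) (at 0)" by simp
  qed auto
  then show ?thesis by (simp add: has_derivative_at blinfun.bounded_linear_right)
qed

text \<open>With d = norm (x - y) and norm h = d, the value g (y + h) is bounded below by the
  tangent at y and above by the estimate at x, whose displacement has norm at most 2d. This bounds
  (L y - L x) h by K (2d)^p on the sphere of radius d; dividing by d gives the operator
  norm.\<close>

lemma tangent_difference_bound:
  fixes g :: "'a::real_normed_vector \<Rightarrow> real" and L :: "'a \<Rightarrow> 'a \<Rightarrow>\<^sub>L real"
  assumes "1 < p" "0 \<le> K"
    and lower: "\<And>x h. g x + L x h \<le> g (x + h)"
    and upper: "\<And>x h. g (x + h) \<le> g x + L x h + K * norm h powr p"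
  shows "norm (L x - L y) \<le> K * 2 powr p * norm (x - y) powr (p - 1)"
proof (cases "x = y")
  case False
  define d where "d = norm (x - y)"
  have d: "0 < d" using False by (simp add: d_def)
  have key: "L y h - L x h \<le> K * (2 * d) powr p" if h: "norm h = d" for h
  proof -
    have "g y + L y h \<le> g (y + h)" by (rule lower)
    also have "\<dots> = g (x + (y - x + h))" by simp
    also have "\<dots> \<le> g x + L x (y - x + h) + K * norm (y - x + h) powr p" by (rule upper)
    also have "L x (y - x + h) = L x (y - x) + L x h" by (rule blinfun.add_right)
    also have "norm (y - x + h) powr p \<le> (2 * d) powr p"
      using norm_triangle_ineq[of "y - x" h] h assms(1)
      by (intro powr_mono2) (auto simp: d_def norm_minus_commute)
    \<comment> \<open>The tangent at x evaluated at y, g x + L x (y - x) \<le> g y, eliminates the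
      function values.\<close>
    finally show ?thesis using lower[of x "y - x"] assms(2) by (simp add: mult_left_mono)
  qed
  have both: "\<bar>(L x - L y) h\<bar> \<le> K * (2 * d) powr p" if "norm h = d" for h
    using key[of h] key[of "- h"] that by (auto simp: blinfun.minus_right blinfun.diff_left)
  show ?thesis
  proof (rule norm_blinfun_bound)
    fix h
    show "norm ((L x - L y) h) \<le> K * 2 powr p * norm (x - y) powr (p - 1) * norm h"
    proof (cases "h = 0")
      case False
      have "\<bar>(L x - L y) ((d / norm h) *\<^sub>R h)\<bar> \<le> K * (2 * d) powr p"
        by (rule both) (use False d in simp)
      then have "d / norm h * \<bar>(L x - L y) h\<bar> \<le> K * (2 * d) powr p"
        using d by (simp add: blinfun.scaleR_right abs_mult)
      then have "\<bar>(L x - L y) h\<bar> \<le> K * (2 * d) powr p / d * norm h"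
        using False d by (simp add: field_simps)
      also have "K * (2 * d) powr p / d = K * 2 powr p * d powr (p - 1)"
        using d by (simp add: powr_mult powr_diff)
      finally show ?thesis by (simp add: d_def)
    qed simp
  qed (use assms in simp)
qed simp

lemma gradient_eqI:
  fixes L :: "'a::real_normed_vector \<Rightarrow>\<^sub>L real"
  assumes "(g has_derivative blinfun_apply L) (at x)"
  shows "gradient g x = L"
  by (simp add: gradient_def blinfun_apply_inverse flip: frechet_derivative_at[OF assms])

section \<open>The Moreau--Yosida regularization\<close>

text \<open>Lower semicontinuity bounds \<open>f\<close> below on a ball around a point
  \<open>x0\<close> of its domain. If \<open>f\<close> were too small at a distant y, convexity
  along the segment from \<open>x0\<close> to y would violate that bound on the sphere.\<close>

lemma Gamma0_linear_minorant:
  fixes f :: "'a::real_normed_vector \<Rightarrow> ereal"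
  assumes "f \<in> Gamma0"
  obtains A B where "0 \<le> B" "\<And>y. ereal (A - B * norm y) \<le> f y"
proof -
  have fin: "\<And>x. f x \<noteq> -\<infinity>" and conv: "ereal_convex f" and lsc: "lower_semicontinuous f"
    using assms by (auto simp: Gamma0_def)
  obtain x0 where "f x0 \<noteq> \<infinity>" using assms by (auto simp: Gamma0_def)
  then obtain r0 where r0: "f x0 = ereal r0" using fin[of x0] by (cases "f x0") auto
  have "\<forall>\<^sub>F y in nhds x0. ereal (r0 - 1) < f y"
    using lsc r0 unfolding lower_semicontinuous_def by simp
  then obtain e where e: "0 < e" "\<And>y. dist y x0 < e \<Longrightarrow> ereal (r0 - 1) < f y"
    unfolding eventually_nhds_metric by auto
  define d where "d = e / 2"
  have d: "0 < d" "\<And>y. dist y x0 \<le> d \<Longrightarrow> ereal (r0 - 1) < f y" using e by (auto simp: d_def)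
  have minorant: "ereal (r0 - 1 - norm (y - x0) / d) \<le> f y" for y
  proof (cases "norm (y - x0) \<le> d")
    case True
    have "ereal (r0 - 1 - norm (y - x0) / d) \<le> ereal (r0 - 1)" using d by simp
    also have "\<dots> \<le> f y" using d(2)[of y] True by (simp add: dist_norm less_imp_le)
    finally show ?thesis .
  next
    case False
    \<comment> \<open>Chosen so that (1 - t) x0 + t y lies at distance exactly \<open>d\<close> from
      \<open>x0\<close>.\<close>
    define t where "t = d / norm (y - x0)"
    have "0 < norm (y - x0)" using False d(1) by linarith
    then have t: "0 < t" "t < 1" using False d(1) by (simp_all add: t_def del: zero_less_norm_iff)
    show ?thesis
    proof (cases "f y")
      case (real s)
      have "dist ((1 - t) *\<^sub>R x0 + t *\<^sub>R y) x0 = norm (t *\<^sub>R (y - x0))"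
        by (simp add: dist_norm algebra_simps)
      also have "\<dots> = d" using False d by (auto simp: t_def)
      finally have "ereal (r0 - 1) < f ((1 - t) *\<^sub>R x0 + t *\<^sub>R y)" by (intro d) simp
      also have "\<dots> \<le> ereal (1 - t) * f x0 + ereal t * f y"
        using conv t unfolding ereal_convex_def by auto
      finally have "r0 - 1 < (1 - t) * r0 + t * s" using real r0 by simp
      then have "r0 - 1 / t < s" using t by (simp add: field_simps)
      then show ?thesis using real by (simp add: t_def)
    qed (use fin in auto)
  qed
  show thesis
  proof
    show "0 \<le> 1 / d" using d by simp
    fix y
    have "norm (y - x0) / d \<le> (norm y + norm x0) / d"
      using d by (intro divide_right_mono norm_triangle_ineq4) auto
    then have "ereal (r0 - 1 - norm x0 / d - 1 / d * norm y) \<le> ereal (r0 - 1 - norm (y - x0) / d)"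
      by (simp add: add_divide_distrib)
    then show "ereal (r0 - 1 - norm x0 / d - 1 / d * norm y) \<le> f y"
      using minorant by (rule order_trans)
  qed
qed

lemma moreau_yosida_le:
  assumes "f y \<le> ereal r"
  shows "moreau_yosida p \<epsilon> f x \<le> ereal (r + 1 / (p * \<epsilon>) * norm (x - y) powr p)"
proof -
  have "moreau_yosida p \<epsilon> f x \<le> f y + ereal (1 / (p * \<epsilon>) * norm (x - y) powr p)"
    unfolding moreau_yosida_def by (rule INF_lower) simp
  also have "\<dots> \<le> ereal r + ereal (1 / (p * \<epsilon>) * norm (x - y) powr p)"
    using assms by (rule add_right_mono)
  finally show ?thesis by simp
qed

text \<open>Below, the power of norm (x - y) absorbs the linear minorant of \<open>f\<close>, since
  norm y \<le> norm x + norm (x - y). Above, any point of the domain of \<open>f\<close> serves as a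
  competitor.\<close>

lemma moreau_yosida_finite:
  fixes f :: "'a::real_normed_vector \<Rightarrow> ereal"
  assumes "f \<in> Gamma0" "1 < p" "0 < \<epsilon>"
  shows "\<bar>moreau_yosida p \<epsilon> f x\<bar> \<noteq> \<infinity>"
proof -
  define k where "k = 1 / (p * \<epsilon>)"
  have k: "0 < k" using assms by (simp add: k_def)
  obtain A B where B: "0 \<le> B" and AB: "\<And>y. ereal (A - B * norm y) \<le> f y"
    using Gamma0_linear_minorant[OF assms(1)] by blast
  obtain c where c: "\<And>t. 0 \<le> t \<Longrightarrow> c \<le> k * t powr p - B * t"
    using powr_dominates_linear[OF k B assms(2)] by blast
  have "ereal (A - B * norm x + c) \<le> moreau_yosida p \<epsilon> f x"
    unfolding moreau_yosida_def
  proof (rule INF_greatest)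
    fix y
    have "B * norm y \<le> B * (norm x + norm (x - y))"
      using B norm_triangle_ineq4[of x "x - y"] by (intro mult_left_mono) auto
    then have "A - B * norm x + c \<le> A - B * norm y + k * norm (x - y) powr p"
      using c[of "norm (x - y)"] by (simp add: algebra_simps)
    then have "ereal (A - B * norm x + c) \<le> ereal (A - B * norm y) + ereal (k * norm (x - y) powr p)"
      by simp
    also have "\<dots> \<le> f y + ereal (k * norm (x - y) powr p)" by (rule add_right_mono[OF AB])
    finally show "ereal (A - B * norm x + c) \<le> f y + ereal (1 / (p * \<epsilon>) * norm (x - y) powr p)"
      by (simp add: k_def)
  qed
  moreover obtain y r where "f y = ereal r"
    using assms(1) unfolding Gamma0_def by (auto, metis ereal_cases)
  then have "moreau_yosida p \<epsilon> f x \<le> ereal (r + 1 / (p * \<epsilon>) * norm (x - y) powr p)"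
    by (intro moreau_yosida_le) simp
  ultimately show ?thesis by auto
qed

lemma moreau_yosida_near_minimizer:
  assumes "\<And>y. f y \<noteq> -\<infinity>" and "moreau_yosida p \<epsilon> f x < ereal c"
  obtains y r where "f y = ereal r" "r + 1 / (p * \<epsilon>) * norm (x - y) powr p < c"
proof -
  obtain y where y: "f y + ereal (1 / (p * \<epsilon>) * norm (x - y) powr p) < ereal c"
    using assms(2) unfolding moreau_yosida_def INF_less_iff by auto
  then obtain r where "f y = ereal r" using assms(1)[of y] by (cases "f y") auto
  then show thesis using y that by simp
qed

section \<open>Convexity, second differences and gradient of the regularization\<close>

theorem mainTheorem2:
  fixes f :: "'a::banach \<Rightarrow> ereal" and p \<epsilon> :: real
  assumes "strictly_convex_space TYPE('a)"
    and "1 < p" and "p \<le> 2"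
    and "p_smooth_space TYPE('a) p"
    and "0 < \<epsilon>"
    and "f \<in> Gamma0"
  defines "g \<equiv> \<lambda>x. real_of_ereal (moreau_yosida p \<epsilon> f x)"
  shows "(\<forall>x. \<bar>moreau_yosida p \<epsilon> f x\<bar> \<noteq> \<infinity>) \<and>
         (\<forall>x. g differentiable (at x)) \<and>
         (\<exists>C>0. \<forall>x y. norm (gradient g x - gradient g y) \<le> C * norm (x - y) powr (p - 1))"
proof -
  define k where "k = 1 / (p * \<epsilon>)"
  have k: "0 < k" using assms by (simp add: k_def)
  have finite: "\<bar>moreau_yosida p \<epsilon> f x\<bar> \<noteq> \<infinity>" for x
    by (rule moreau_yosida_finite) fact+
  then have g_eq: "moreau_yosida p \<epsilon> f x = ereal (g x)" for x
    by (simp add: g_def ereal_real)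
  have f_fin: "f y \<noteq> -\<infinity>" for y using assms(6) by (simp add: Gamma0_def)
  have g_le: "g x \<le> r + k * norm (x - y) powr p" if "f y \<le> ereal r" for x y r
    using moreau_yosida_le[where f = f, OF that, of p \<epsilon> x] by (simp add: g_eq k_def)
  \<comment> \<open>Near-minimizers stand in for an attained infimum; the slack \<open>e\<close> is
    removed later by \<open>field_le_epsilon\<close>.\<close>
  have g_near: "\<exists>y r. f y = ereal r \<and> r + k * norm (x - y) powr p < g x + e" if "0 < e" for x e
    using moreau_yosida_near_minimizer[where f = f and c = "g x + e", OF f_fin, of p \<epsilon> x] that
    by (metis g_eq k_def less_add_same_cancel1 less_ereal.simps(1))

  have conv: "convex_on UNIV g"
    unfolding convex_on_def
  proof (intro conjI ballI allI impI)
    fix x x' :: 'a and u v :: real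
    assume uv: "0 \<le> u" "0 \<le> v" "u + v = 1"
    show "g (u *\<^sub>R x + v *\<^sub>R x') \<le> u * g x + v * g x'"
    proof (rule field_le_epsilon)
      fix e :: real assume e: "0 < e"
      obtain y r where y: "f y = ereal r" "r + k * norm (x - y) powr p < g x + e"
        using g_near[OF e, of x] by blast
      obtain y' r' where y': "f y' = ereal r'" "r' + k * norm (x' - y') powr p < g x' + e"
        using g_near[OF e, of x'] by blast
      \<comment> \<open>The convex combination of the two near-minimizers is the competitor at the
        combined point.\<close>
      have "f (u *\<^sub>R y + v *\<^sub>R y') \<le> ereal u * f y + ereal v * f y'"
        using assms(6) uv unfolding Gamma0_def ereal_convex_def by blast
      then have "g (u *\<^sub>R x + v *\<^sub>R x')
        \<le> (u * r + v * r') + k * norm (u *\<^sub>R x + v *\<^sub>R x' - (u *\<^sub>R y + v *\<^sub>R y')) powr p"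
        by (intro g_le) (simp add: y y')
      also have "u *\<^sub>R x + v *\<^sub>R x' - (u *\<^sub>R y + v *\<^sub>R y') = u *\<^sub>R (x - y) + v *\<^sub>R (x' - y')"
        by (simp add: algebra_simps)
      also have "k * norm (u *\<^sub>R (x - y) + v *\<^sub>R (x' - y')) powr p
        \<le> k * (u * norm (x - y) powr p + v * norm (x' - y') powr p)"
        using k uv assms(2) by (intro mult_left_mono norm_powr_convex) auto
      also have "(u * r + v * r') + \<dots>
        = u * (r + k * norm (x - y) powr p) + v * (r' + k * norm (x' - y') powr p)"
        by (simp add: algebra_simps)
      also have "\<dots> \<le> u * (g x + e) + v * (g x' + e)"
        by (intro add_mono[of "u * _" _ "v * _"] mult_left_mono) (use y y' uv in auto)
      also have "\<dots> = u * g x + v * g x' + (u + v) * e" by (simp add: algebra_simps)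
      finally show "g (u *\<^sub>R x + v *\<^sub>R x') \<le> u * g x + v * g x' + e" using uv by simp
    qed
  qed simp

  obtain K0 where K0: "0 < K0" "\<And>x h :: 'a. norm (x + h) powr p + norm (x - h) powr p
      - 2 * norm x powr p \<le> K0 * norm h powr p"
    using norm_powr_second_difference[OF assms(4,2,3)] by blast
  define K where "K = k * K0"
  have K: "0 < K" using k K0 by (simp add: K_def)
  \<comment> \<open>One near-minimizer y for x is the competitor at both x + h and x - h. The values
    of \<open>f\<close> cancel, leaving the second difference of k norm(.)^p at x - y. The slack e/2
    enters twice, through 2 g x.\<close>
  have diff2: "g (x + h) + g (x - h) - 2 * g x \<le> K * norm h powr p" for x h
  proof (rule field_le_epsilon)
    fix e :: real assume e: "0 < e"
    obtain y r where y: "f y = ereal r" "r + k * norm (x - y) powr p < g x + e / 2"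
      using g_near[of "e / 2" x] e by auto
    have "g (x + h) \<le> r + k * norm (x - y + h) powr p" "g (x - h) \<le> r + k * norm (x - y - h) powr p"
      using g_le[of y r "x + h"] g_le[of y r "x - h"] y by (simp_all add: algebra_simps)
    moreover have "k * (norm (x - y + h) powr p + norm (x - y - h) powr p - 2 * norm (x - y) powr p)
      \<le> k * (K0 * norm h powr p)"
      using k by (intro mult_left_mono K0) auto
    ultimately show "g (x + h) + g (x - h) - 2 * g x \<le> K * norm h powr p + e"
      using y by (simp add: K_def algebra_simps)
  qed

  \<comment> \<open>A single competitor y from the domain of \<open>f\<close> serves the whole unit
    ball around x.\<close>
  have bdd: "\<exists>M. \<forall>h. norm h \<le> 1 \<longrightarrow> g (x + h) \<le> M" for x
  proof -
    obtain y r where y: "f y = ereal r" using g_near[of 1] by fastforce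
    have "g (x + h) \<le> r + k * (norm (x - y) + 1) powr p" if "norm h \<le> 1" for h
    proof -
      have "norm (x + h - y) \<le> norm (x - y) + 1"
        using norm_triangle_ineq[of "x - y" h] that by (simp add: algebra_simps)
      then have "k * norm (x + h - y) powr p \<le> k * (norm (x - y) + 1) powr p"
        using k assms(2) by (intro mult_left_mono powr_mono2) auto
      then show ?thesis using g_le[of y r "x + h"] y by simp
    qed
    then show ?thesis by blast
  qed

  have "\<exists>L :: 'a \<Rightarrow>\<^sub>L real. \<forall>h. g x + L h \<le> g (x + h) \<and> g (x + h) \<le> g x + L h + K * norm h powr p" for x
  proof -
    obtain M where "\<And>h. norm h \<le> 1 \<Longrightarrow> g (x + h) \<le> M" using bdd by blast
    from convex_second_difference_tangent[OF conv assms(2) diff2 this] show ?thesis by metis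
  qed
  then obtain L :: "'a \<Rightarrow> 'a \<Rightarrow>\<^sub>L real" where L: "\<And>x h. g x + L x h \<le> g (x + h)"
      "\<And>x h. g (x + h) \<le> g x + L x h + K * norm h powr p"
    by metis
  have deriv: "(g has_derivative blinfun_apply (L x)) (at x)" for x
  proof (rule has_derivative_if_powr_remainder[OF assms(2)])
    show "\<bar>g (x + h) - g x - L x h\<bar> \<le> K * norm h powr p" for h
      using L[of x h] by simp
  qed
  then have "gradient g x = L x" for x by (rule gradient_eqI)
  then have "norm (gradient g x - gradient g y) \<le> K * 2 powr p * norm (x - y) powr (p - 1)" for x y
    using tangent_difference_bound[OF assms(2) _ L] K by simp
  moreover have "0 < K * 2 powr p" using K by simp
  ultimately show ?thesis using finite deriv unfolding differentiable_def by blast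
qed

end
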